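(* Let $\mathbb{K}/\mathbb{F}$ be an extension of finite fields, let $N, T, M, B$ be positive integers with $T<N$, and suppose that $N-T$ divides $B$. Let $\mathcal{C}=\mathrm{Rep}(N)_{\mathbb{F}}$ be the repetition code (so $K=1$ and each of the $N$ servers stores a copy of the data vector $\mathbf{X}\in\mathbb{K}^{M\times 1}$), and let $\mathcal{D}$ be an $[N,T]_{\mathbb{F}}$ MDS code. Let $\mathcal{Q}$ be any $\mathbb{F}$-linear query space, i.e. any $\mathbb{F}$-subspace of the space of all functions $\mathbb{K}^{M\times 1}\to\mathbb{K}$, and let $\mathsf{Q}$ be any random variable on $\mathcal{Q}^B$, from which the functions $(\phi_1,\ldots,\phi_B)$ to be evaluated are sampled. Then the replicated-data star-product PC scheme built from $\mathcal{D}$ (described in the context) is a PC scheme that protects against $T$-collusion and has download rate $(N-T)/N$.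
   Context: **Private Computation (PC) model.** Let $\mathbb{K}/\mathbb{F}$ be an extension of finite fields. A data matrix $\mathbf{X}=[\mathbf{x}_1\cdots\mathbf{x}_K]\in\mathbb{K}^{M\times K}$ is encoded with an $[N,K]_{\mathbb{F}}$ linear code $\mathcal{C}$ with generator matrix $\mathbf{G}_{\mathcal{C}}\in\mathbb{F}^{K\times N}$ as $\mathbf{Y}=\mathbf{X}\cdot\mathbf{G}_{\mathcal{C}}=[\mathbf{y}_1\cdots\mathbf{y}_N]\in\mathbb{K}^{M\times N}$; server $n$ stores $\mathbf{y}_n\in\mathbb{K}^{M\times 1}$. Here $\mathcal{C}$ is the repetition code $\mathrm{Rep}(N)_{\mathbb{F}}$ with generator matrix $[1,\ldots,1]$, so $K=1$ and $\mathbf{y}_n=\mathbf{X}$ for all $n$. Let $\mathcal{F}$ be the set of all functions $\mathbb{K}^{M\times 1}\to\mathbb{K}$. A PC scheme with block length $B$ consists of: a query space $\mathcal{Q}\subseteq\mathcal{F}$ and a random variable $\mathsf{Q}$ on $\mathcal{Q}^B$ (both public) from which functions $\phi_1,\ldots,\phi_B$ are sampled; queries $\rho_1,\ldots,\rho_N\in\mathcal{Q}$, with $\rho_n$ sent to server $n$; responses $\rho_n(\mathbf{y}_n)\in\mathbb{K}$, giving the user the total response vector $\boldsymbol{\rho}(\mathbf{Y})=[\rho_1(\mathbf{y}_1),\ldots,\rho_N(\mathbf{y}_N)]$; and the repetition of the query/response steps a total of $S$ times (with new queries each time) such that all values $\phi_b(\mathbf{x}_k)$, $1\le b\le B$, $1\le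 k\le K$, can be computed by the user from the $S$ total response vectors. **Rate.** The (download) rate is $R=\frac{KB}{NS}$. **Collusion.** A PC scheme protects against a set of servers $\mathcal{T}\subseteq[N]$ if $I(\mathsf{Q};\mathsf{P}_{\mathcal{T}})=0$ (mutual information), where $\mathsf{P}_{\mathcal{T}}$ is the random variable given by all queries sent to all servers in $\mathcal{T}$ over all $S$ iterations. It protects against $T$-collusion if it protects against every $\mathcal{T}\subseteq[N]$ with $|\mathcal{T}|=T$. **The scheme.** An $[N,T]_{\mathbb{F}}$ code is a $T$-dimensional subspace of $\mathbb{F}^{1\times N}$; it is MDS if its minimum distance is $N-T+1$. Fix an $\mathbb{F}$-basis $\{\psi^1,\ldots,\psi^Q\}$ of $\mathcal{Q}$, $Q=\dim_{\mathbb{F}}\mathcal{Q}$. There are $S=B/(N-T)$ iterations. In iteration $s$ ($1\le s\le S$), sample codewords $\mathbf{d}^1,\ldots,\mathbf{d}^Q\in\mathcal{D}$ independently and uniformly (independently of $(\phi_1,\ldots,\phi_B)$ and of the other iterations), and put $\psi_n=\mathbf{d}^1(n)\psi^1+\cdots+\mathbf{d}^Q(n)\psi^Q\in\mathcal{Q}$ for $n=1,\ldots,N$, where $\mathbf{d}^q(n)$ is the $n$-th coordinate of $\mathbf{d}^q$. The queries are $\rho_n=\psi_n+\phi_{(s-1)(N-T)+n}$ if $n\le N-T$, and $\rho_n=\psi_n$ if $n>N-T$. The user right-multiplies the total response vector by a parity-check matrix $\mathbf{H}_{\mathcal{D}}\in\mathbb{F}^{N\times(N-T)}$ of $\mathcal{D}$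 (so $\mathbf{d}\mathbf{H}_{\mathcal{D}}=\mathbf{0}$ for $\mathbf{d}\in\mathcal{D}$) in systematic form (its first $N-T$ rows form the identity matrix). *)

theory Defs
  imports "HOL-Probability.Probability" "HOL-Library.Function_Algebras"
begin

section \<open>Field extensions and vector spaces of functions\<close>

text \<open>The extension \<open>K/F\<close> is given by two field types and an embedding of \<open>F\<close> into \<open>K\<close>
  (injective, since the domain is a field and \<open>1\<close> is preserved).\<close>

definition field_embedding :: "('f::field \<Rightarrow> 'k::field) \<Rightarrow> bool" where
  "field_embedding \<iota> \<longleftrightarrow>
     \<iota> 1 = 1 \<and> (\<forall>a b. \<iota> (a + b) = \<iota> a + \<iota> b) \<and> (\<forall>a b. \<iota> (a * b) = \<iota> a * \<iota> b)"

definition row_scale :: "'f::field \<Rightarrow> (nat \<Rightarrow> 'f) \<Rightarrow> nat \<Rightarrow> 'f" where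
  "row_scale c v = (\<lambda>n. c * v n)"

lemma vector_space_row_scale: "vector_space (row_scale :: 'f::field \<Rightarrow> _)"
  by standard (auto simp: row_scale_def fun_eq_iff algebra_simps)

definition fn_scale :: "('f::field \<Rightarrow> 'k::field) \<Rightarrow> 'f \<Rightarrow> ('x \<Rightarrow> 'k) \<Rightarrow> 'x \<Rightarrow> 'k" where
  "fn_scale \<iota> c g = (\<lambda>x. \<iota> c * g x)"

lemma vector_space_fn_scale:
  assumes "field_embedding \<iota>"
  shows "vector_space (fn_scale \<iota>)"
  using assms
  by unfold_locales (auto simp: field_embedding_def fn_scale_def fun_eq_iff algebra_simps)

definition indexed_basis ::
    "('f::field \<Rightarrow> 'v::ab_group_add \<Rightarrow> 'v) \<Rightarrow> 'v set \<Rightarrow> nat \<Rightarrow> (nat \<Rightarrow> 'v) \<Rightarrow> bool" where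
  "indexed_basis sc V m v \<longleftrightarrow>
     inj_on v {1..m} \<and> \<not> module.dependent sc (v ` {1..m}) \<and> module.span sc (v ` {1..m}) = V"


section \<open>Linear codes\<close>

text \<open>Coordinates are numbered \<open>1, \<dots>, N\<close>; a row vector of length \<open>N\<close> is a function that
  vanishes outside this range.\<close>

definition row_vectors :: "nat \<Rightarrow> (nat \<Rightarrow> 'f::field) set" where
  "row_vectors N = {v. \<forall>n. n \<notin> {1..N} \<longrightarrow> v n = 0}"

definition linear_code :: "nat \<Rightarrow> nat \<Rightarrow> (nat \<Rightarrow> 'f::field) set \<Rightarrow> bool" where
  "linear_code N k C \<longleftrightarrow>
     C \<subseteq> row_vectors N \<and> module.subspace row_scale C \<and> vector_space.dim row_scale C = k"

definition hamming_dist :: "nat \<Rightarrow> (nat \<Rightarrow> 'f::field) \<Rightarrow> (nat \<Rightarrow> 'f) \<Rightarrow> nat" where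
  "hamming_dist N u v = card {n \<in> {1..N}. u n \<noteq> v n}"

definition min_distance :: "nat \<Rightarrow> (nat \<Rightarrow> 'f::field) set \<Rightarrow> nat" where
  "min_distance N C = Min {hamming_dist N u v | u v. u \<in> C \<and> v \<in> C \<and> u \<noteq> v}"

definition mds_code :: "nat \<Rightarrow> nat \<Rightarrow> (nat \<Rightarrow> 'f::field) set \<Rightarrow> bool" where
  "mds_code N k C \<longleftrightarrow> linear_code N k C \<and> min_distance N C = N - k + 1"

text \<open>A generator matrix is given by its rows \<open>G 1, \<dots>, G k\<close>.\<close>

definition generator_matrix ::
    "nat \<Rightarrow> nat \<Rightarrow> (nat \<Rightarrow> 'f::field) set \<Rightarrow> (nat \<Rightarrow> nat \<Rightarrow> 'f) \<Rightarrow> bool" where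
  "generator_matrix N k C G \<longleftrightarrow> linear_code N k C \<and> indexed_basis row_scale C k G"

definition repetition_generator :: "nat \<Rightarrow> nat \<Rightarrow> nat \<Rightarrow> 'f::field" where
  "repetition_generator N = (\<lambda>k n. if n \<in> {1..N} then 1 else 0)"

definition repetition_code :: "nat \<Rightarrow> (nat \<Rightarrow> 'f::field) set" where
  "repetition_code N = module.span row_scale {repetition_generator N 1}"

text \<open>\<open>H n j\<close> is the entry in row \<open>n\<close> and column \<open>j\<close> of an \<open>N \<times> (N - k)\<close> matrix.\<close>

definition parity_check_matrix ::
    "nat \<Rightarrow> nat \<Rightarrow> (nat \<Rightarrow> 'f::field) set \<Rightarrow> (nat \<Rightarrow> nat \<Rightarrow> 'f) \<Rightarrow> bool" where
  "parity_check_matrix N k C H \<longleftrightarrow>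
     C = {d \<in> row_vectors N. \<forall>j\<in>{1..N - k}. (\<Sum>n=1..N. d n * H n j) = 0}"

definition systematic :: "nat \<Rightarrow> nat \<Rightarrow> (nat \<Rightarrow> nat \<Rightarrow> 'f::field) \<Rightarrow> bool" where
  "systematic N k H \<longleftrightarrow>
     (\<forall>i\<in>{1..N - k}. \<forall>j\<in>{1..N - k}. H i j = (if i = j then 1 else 0))"


section \<open>Private computation schemes\<close>

text \<open>Columns of a data matrix have type \<open>'k ^ 'm\<close>, with \<open>M = CARD('m)\<close>; the data matrix is
  given by its columns \<open>X 1, \<dots>, X K\<close>.\<close>

type_synonym ('k, 'm) fn = "'k ^ 'm \<Rightarrow> 'k"

text \<open>\<open>function_law\<close> is the distribution of \<open>(\<phi> 1, \<dots>, \<phi> B)\<close>. Given the sampled \<open>\<phi>\<close>,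
  \<open>query_law \<phi>\<close> is the distribution of the queries; \<open>\<rho> s n\<close> is the one sent to server \<open>n\<close> in
  iteration \<open>s\<close>. \<open>decode r b k\<close> is the value computed for \<open>\<phi> b (X k)\<close> from the responses
  \<open>r s n\<close>.\<close>

record ('k, 'm) pc_scheme =
  query_space :: "('k, 'm) fn set"
  block_length :: nat
  iterations :: nat
  function_law :: "(nat \<Rightarrow> ('k, 'm) fn) pmf"
  query_law :: "(nat \<Rightarrow> ('k, 'm) fn) \<Rightarrow> (nat \<Rightarrow> nat \<Rightarrow> ('k, 'm) fn) pmf"
  decode :: "(nat \<Rightarrow> nat \<Rightarrow> 'k) \<Rightarrow> nat \<Rightarrow> nat \<Rightarrow> 'k"

definition scheme_law ::
    "('k, 'm) pc_scheme \<Rightarrow> ((nat \<Rightarrow> ('k, 'm) fn) \<times> (nat \<Rightarrow> nat \<Rightarrow> ('k, 'm) fn)) pmf" where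
  "scheme_law P = bind_pmf (function_law P) (\<lambda>\<phi>. map_pmf (Pair \<phi>) (query_law P \<phi>))"

definition server_data ::
    "('f::field \<Rightarrow> 'k::field) \<Rightarrow> nat \<Rightarrow> (nat \<Rightarrow> nat \<Rightarrow> 'f) \<Rightarrow> (nat \<Rightarrow> 'k ^ 'm::finite) \<Rightarrow> nat \<Rightarrow> 'k ^ 'm"
  where
  "server_data \<iota> K G X n = (\<Sum>k=1..K. \<iota> (G k n) *s X k)"

text \<open>The total response vectors passed to the decoder are cut down to the \<open>S\<close> iterations and
  \<open>N\<close> servers.\<close>

definition is_pc_scheme ::
    "('f::field \<Rightarrow> 'k::field) \<Rightarrow> nat \<Rightarrow> nat \<Rightarrow> (nat \<Rightarrow> 'f) set \<Rightarrow> (nat \<Rightarrow> nat \<Rightarrow> 'f)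
      \<Rightarrow> ('k, 'm::finite) pc_scheme \<Rightarrow> bool" where
  "is_pc_scheme \<iota> N K C G P \<longleftrightarrow>
     generator_matrix N K C G \<and>
     set_pmf (function_law P) \<subseteq> ({1..block_length P} \<rightarrow>\<^sub>E query_space P) \<and>
     (\<forall>(\<phi>, \<rho>) \<in> set_pmf (scheme_law P).
        (\<forall>s\<in>{1..iterations P}. \<forall>n\<in>{1..N}. \<rho> s n \<in> query_space P) \<and>
        (\<forall>X. \<forall>b\<in>{1..block_length P}. \<forall>k\<in>{1..K}.
           decode P (\<lambda>s\<in>{1..iterations P}. \<lambda>n\<in>{1..N}. \<rho> s n (server_data \<iota> K G X n)) b k
             = \<phi> b (X k)))"

definition download_rate :: "nat \<Rightarrow> nat \<Rightarrow> ('k, 'm) pc_scheme \<Rightarrow> real" where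
  "download_rate N K P =
     (real K * real (block_length P)) / (real N * real (iterations P))"

definition requested_functions ::
    "('k, 'm) pc_scheme \<Rightarrow> (nat \<Rightarrow> ('k, 'm) fn) \<times> (nat \<Rightarrow> nat \<Rightarrow> ('k, 'm) fn)
      \<Rightarrow> nat \<Rightarrow> ('k, 'm) fn" where
  "requested_functions P = (\<lambda>(\<phi>, \<rho>). restrict \<phi> {1..block_length P})"

definition observed_queries ::
    "('k, 'm) pc_scheme \<Rightarrow> nat set \<Rightarrow> (nat \<Rightarrow> ('k, 'm) fn) \<times> (nat \<Rightarrow> nat \<Rightarrow> ('k, 'm) fn)
      \<Rightarrow> nat \<times> nat \<Rightarrow> ('k, 'm) fn" where
  "observed_queries P \<T> = (\<lambda>(\<phi>, \<rho>). restrict (\<lambda>(s, n). \<rho> s n) ({1..iterations P} \<times> \<T>))"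

text \<open>Mutual information in bits. By the restrictions above both random variables are
  finite-valued when \<open>'k\<close> and \<open>\<T>\<close> are finite.\<close>

definition protects_against :: "nat set \<Rightarrow> ('k, 'm) pc_scheme \<Rightarrow> bool" where
  "protects_against \<T> P \<longleftrightarrow>
     prob_space.mutual_information (measure_pmf (scheme_law P)) 2
       (count_space (range (requested_functions P)))
       (count_space (range (observed_queries P \<T>)))
       (requested_functions P) (observed_queries P \<T>) = 0"

definition protects_against_collusion :: "nat \<Rightarrow> nat \<Rightarrow> ('k, 'm) pc_scheme \<Rightarrow> bool" where
  "protects_against_collusion N T P \<longleftrightarrow>
     (\<forall>\<T>. \<T> \<subseteq> {1..N} \<and> card \<T> = T \<longrightarrow> protects_against \<T> P)"


section \<open>The star-product scheme for replicated data\<close>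

text \<open>\<open>d (s, q)\<close> is the \<open>q\<close>-th codeword sampled in iteration \<open>s\<close>.\<close>

definition star_query ::
    "('f::field \<Rightarrow> 'k::field) \<Rightarrow> nat \<Rightarrow> nat \<Rightarrow> nat \<Rightarrow> (nat \<Rightarrow> ('k, 'm) fn) \<Rightarrow> (nat \<Rightarrow> ('k, 'm) fn)
      \<Rightarrow> (nat \<times> nat \<Rightarrow> nat \<Rightarrow> 'f) \<Rightarrow> nat \<Rightarrow> nat \<Rightarrow> ('k, 'm) fn" where
  "star_query \<iota> N T Q \<psi> \<phi> d s n =
     (\<Sum>q=1..Q. fn_scale \<iota> (d (s, q) n) (\<psi> q)) +
     (if n \<le> N - T then \<phi> ((s - 1) * (N - T) + n) else 0)"

text \<open>The decoder reads \<open>\<phi> b (X 1)\<close>, where \<open>b = (s - 1) (N - T) + j\<close> with \<open>1 \<le> j \<le> N - T\<close>,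
  from column \<open>j\<close> of the product of the \<open>s\<close>-th total response vector with \<open>H\<close>.\<close>

definition star_product_scheme ::
    "('f::{field,finite} \<Rightarrow> 'k::{field,finite}) \<Rightarrow> nat \<Rightarrow> nat \<Rightarrow> nat \<Rightarrow> (nat \<Rightarrow> 'f) set
      \<Rightarrow> (nat \<Rightarrow> nat \<Rightarrow> 'f) \<Rightarrow> ('k, 'm::finite) fn set \<Rightarrow> (nat \<Rightarrow> ('k, 'm) fn)
      \<Rightarrow> (nat \<Rightarrow> ('k, 'm) fn) pmf \<Rightarrow> ('k, 'm) pc_scheme" where
  "star_product_scheme \<iota> N T B D H \<Q> \<psi> law =
     (let S = B div (N - T); Q = vector_space.dim (fn_scale \<iota>) \<Q> in
      \<lparr> query_space = \<Q>,
        block_length = B,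
        iterations = S,
        function_law = law,
        query_law = (\<lambda>\<phi>. map_pmf (star_query \<iota> N T Q \<psi> \<phi>)
                           (Pi_pmf ({1..S} \<times> {1..Q}) 0 (\<lambda>_. pmf_of_set D))),
        decode = (\<lambda>r b k. \<Sum>n=1..N.
                    r ((b - 1) div (N - T) + 1) n * \<iota> (H n ((b - 1) mod (N - T) + 1))) \<rparr>)"

end

theory Submission
  imports Defs
begin

text \<open>Any \<open>T\<close> coordinates of the MDS code are an information set. Hence, for \<open>T\<close> colluding servers,
  the functions \<open>\<phi>\<close> added to their queries agree with the queries produced by some family of
  codewords \<open>\<delta>\<close>, and the uniform law of the codewords is invariant under translation by \<open>\<delta>\<close>. So
  the conditional law of the observed queries does not depend on \<open>\<phi>\<close>. Decoding works because the
  parity-check matrix annihilates the codewords and its systematic part reads off the \<open>\<phi>\<close>.\<close>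

section \<open>Bases\<close>

text \<open>A basis contained in the finite set \<open>V\<close> is itself finite, so it can be
  numbered from 1.\<close>

lemma (in vector_space) indexed_basis_exists:
  assumes "subspace V" and "finite V"
  shows "\<exists>v. indexed_basis scale V (dim V) v"
proof -
  obtain A where A: "A \<subseteq> V" "independent A" "V \<subseteq> span A" "card A = dim V"
    using basis_exists by blast
  have "finite A"
    using A(1) assms(2) by (rule finite_subset)
  then obtain v where "bij_betw v {1..card A} A"
    using ex_bij_betw_nat_finite_1 by blast
  moreover have "span A = V"
    using A assms(1) by (intro span_subspace)
  ultimately show ?thesis
    using A by (auto simp: indexed_basis_def bij_betw_def)
qed

lemma (in vector_space) indexed_basis_expansion:
  assumes "indexed_basis scale V m v" and "x \<in> V"
  obtains a where "x = (\<Sum>q=1..m. scale (a q) (v q))"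
proof -
  have "x \<in> span (v ` {1..m})" and inj: "inj_on v {1..m}"
    using assms by (auto simp: indexed_basis_def)
  then obtain u where "x = (\<Sum>w\<in>v ` {1..m}. scale (u w) w)"
    by (auto simp: span_finite)
  then have "x = (\<Sum>q=1..m. scale (u (v q)) (v q))"
    using inj by (simp add: sum.reindex)
  then show thesis by (rule that)
qed

lemma (in vector_space) indexed_basis_in:
  assumes "indexed_basis scale V m v" and "q \<in> {1..m}"
  shows "v q \<in> V"
  using assms span_base[of "v q" "v ` {1..m}"] by (auto simp: indexed_basis_def)

text \<open>Distinct coefficient families on a basis give distinct vectors of \<open>V\<close>. This
  is the half of the count that makes restriction of an MDS code to \<open>k\<close> coordinates
  surjective.\<close>

lemma (in vector_space) card_ge_power_dim:
  assumes "subspace V" and "finite V" and "finite (UNIV :: 'a set)"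
  shows "CARD('a) ^ dim V \<le> card V"
proof -
  obtain A where A: "A \<subseteq> V" "independent A" "V \<subseteq> span A" "card A = dim V"
    using basis_exists by blast
  have fin: "finite A"
    using A(1) assms(2) by (rule finite_subset)
  define comb where "comb u = (\<Sum>a\<in>A. scale (u a) a)" for u
  have "inj_on comb (A \<rightarrow>\<^sub>E UNIV)"
  proof (rule inj_onI)
    fix u w assume uw: "u \<in> A \<rightarrow>\<^sub>E UNIV" "w \<in> A \<rightarrow>\<^sub>E UNIV" and eq: "comb u = comb w"
    have "(\<Sum>a\<in>A. scale (u a - w a) a) = 0"
      using eq by (simp add: comb_def scale_left_diff_distrib sum_subtractf)
    then have "\<forall>a\<in>A. u a - w a = 0"
      using A(2)[unfolded independent_explicit_finite_subsets, rule_format,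
          of A "\<lambda>a. u a - w a"] fin by blast
    then show "u = w"
      using uw by (intro PiE_ext) auto
  qed
  moreover have "comb ` (A \<rightarrow>\<^sub>E UNIV) \<subseteq> V"
    using A(1) assms(1) by (auto simp: comb_def intro!: subspace_sum subspace_scale)
  ultimately have "card (A \<rightarrow>\<^sub>E (UNIV :: 'a set)) \<le> card V"
    using assms(2) by (intro card_inj_on_le)
  then show ?thesis
    using fin A(4) by (simp add: card_PiE)
qed

section \<open>MDS codes\<close>

interpretation row: vector_space "row_scale :: 'f::field \<Rightarrow> _"
  by (rule vector_space_row_scale)

lemma finite_row_vectors: "finite (row_vectors N :: (nat \<Rightarrow> 'f::{field,finite}) set)"
proof -
  have "row_vectors N = PiE_dflt {1..N} (0::'f) (\<lambda>_. UNIV)"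
    by (auto simp: row_vectors_def PiE_dflt_def)
  then show ?thesis by (simp add: finite_PiE_dflt)
qed

lemma mds_code_finite:
  fixes D :: "(nat \<Rightarrow> 'f::{field,finite}) set"
  assumes "mds_code N k D"
  shows "finite D"
  using assms finite_subset[OF _ finite_row_vectors]
  by (auto simp: mds_code_def linear_code_def)

text \<open>\<open>Min\<close> is a lower bound only for a finite set; finiteness holds because no
  distance exceeds \<open>N\<close>.\<close>

lemma min_distance_le:
  assumes "u \<in> C" and "v \<in> C" and "u \<noteq> v"
  shows "min_distance N C \<le> hamming_dist N u v"
proof -
  have "{hamming_dist N u v |u v. u \<in> C \<and> v \<in> C \<and> u \<noteq> v} \<subseteq> {..N}"
  proof clarsimp
    fix u v :: "nat \<Rightarrow> 'a"
    have "hamming_dist N u v \<le> card {1..N}"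
      unfolding hamming_dist_def by (rule card_mono) auto
    then show "hamming_dist N u v \<le> N" by simp
  qed
  then have "finite {hamming_dist N u v |u v. u \<in> C \<and> v \<in> C \<and> u \<noteq> v}"
    by (rule finite_subset) simp
  then show ?thesis
    unfolding min_distance_def using assms by (intro Min_le) auto
qed

text \<open>Agreement on \<open>k\<close> coordinates leaves at most \<open>N - k\<close> places to
  differ, fewer than the minimum distance.\<close>

lemma mds_code_eqI:
  assumes mds: "mds_code N k D" and I: "I \<subseteq> {1..N}" "card I = k"
    and uv: "u \<in> D" "v \<in> D" and agree: "\<And>n. n \<in> I \<Longrightarrow> u n = v n"
  shows "u = v"
proof (rule ccontr)
  assume "u \<noteq> v"
  then have "N - k + 1 \<le> hamming_dist N u v"
    using min_distance_le[OF uv, of N] mds by (simp add: mds_code_def)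
  also have "\<dots> \<le> card ({1..N} - I)"
    unfolding hamming_dist_def using agree by (intro card_mono) auto
  also have "\<dots> = N - k"
    using I by (simp add: card_Diff_subset finite_subset)
  finally show False by simp
qed

text \<open>Restriction to \<open>k\<close> coordinates is injective by the minimum distance, hence bijective by
  counting.\<close>

lemma mds_code_interpolation:
  fixes D :: "(nat \<Rightarrow> 'f::{field,finite}) set"
  assumes mds: "mds_code N k D" and I: "I \<subseteq> {1..N}" "card I = k"
  obtains d where "d \<in> D" and "\<And>n. n \<in> I \<Longrightarrow> d n = c n"
proof -
  have fin: "finite I" using I(1) by (rule finite_subset) simp
  let ?r = "\<lambda>d. restrict d I"
  have inj: "inj_on ?r D"
    by (intro inj_onI mds_code_eqI[OF mds I]) (metis restrict_apply')+
  have sub: "?r ` D \<subseteq> I \<rightarrow>\<^sub>E UNIV" by auto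
  have "card (I \<rightarrow>\<^sub>E (UNIV :: 'f set)) = CARD('f) ^ k"
    using fin I(2) by (simp add: card_PiE)
  also have "\<dots> \<le> card D"
    using row.card_ge_power_dim[of D] mds mds_code_finite[OF mds]
    by (auto simp: mds_code_def linear_code_def)
  also have "\<dots> = card (?r ` D)"
    using inj by (simp add: card_image)
  finally have "?r ` D = I \<rightarrow>\<^sub>E UNIV"
    using sub fin by (intro card_seteq) (auto intro: finite_PiE)
  then have "restrict c I \<in> ?r ` D" by auto
  then obtain d where "d \<in> D" "restrict c I = restrict d I" by auto
  then show thesis
    by (intro that[of d]) (metis restrict_apply')+
qed

lemma sum_row_scale_apply: "(\<Sum>i\<in>A. row_scale (c i) (v i)) n = (\<Sum>i\<in>A. c i * v i n)"
  by (induction A rule: infinite_finite_induct) (auto simp: row_scale_def)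

text \<open>The codewords \<open>e i\<close> that are unit vectors on the last \<open>k\<close> coordinates form the rows of a
  generator matrix \<open>[A | I]\<close>; the parity-check matrix is \<open>[I; -A]\<close>.\<close>

lemma mds_code_systematic_parity_check:
  fixes D :: "(nat \<Rightarrow> 'f::{field,finite}) set"
  assumes mds: "mds_code N k D" and "k \<le> N"
  shows "\<exists>H. parity_check_matrix N k D H \<and> systematic N k H"
proof -
  define m where "m = N - k"
  let ?I = "{m + 1..N}"
  have I: "?I \<subseteq> {1..N}" "card ?I = k"
    using \<open>k \<le> N\<close> by (auto simp: m_def)
  have "\<exists>d\<in>D. \<forall>n\<in>?I. d n = (if n = i then 1 else 0)" for i
    by (rule mds_code_interpolation[OF mds I, of "\<lambda>n. if n = i then 1 else 0"]) blast
  then obtain e where eD: "\<And>i. e i \<in> D"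
    and e: "\<And>i n. n \<in> ?I \<Longrightarrow> e i n = (if n = i then 1 else 0)"
    by metis
  have sub: "row.subspace D" and DN: "D \<subseteq> row_vectors N"
    using mds by (auto simp: mds_code_def linear_code_def)
  \<comment> \<open>Re-encoding: \<open>comb d\<close> is the codeword with the same last
    \<open>k\<close> entries as \<open>d\<close>. Since these entries determine a codeword, it fixes
    \<open>D\<close> pointwise.\<close>
  define comb where "comb d = (\<Sum>i\<in>?I. row_scale (d i) (e i))" for d
  have combD: "comb d \<in> D" for d
    unfolding comb_def by (intro row.subspace_sum row.subspace_scale sub eD)
  have comb_apply: "comb d n = (\<Sum>i\<in>?I. d i * e i n)" for d n
    by (simp add: comb_def sum_row_scale_apply)
  have comb_I: "comb d n = d n" if "n \<in> ?I" for d n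
    using that by (simp add: comb_apply e if_distrib[of "\<lambda>x. _ * x"] sum.delta cong: if_cong)
  have comb_id: "comb d = d" if "d \<in> D" for d
    using mds_code_eqI[OF mds I combD that] comb_I by blast
  define H where "H n j = (if n \<le> m then (if n = j then 1 else 0) else - e n j)" for n j
  have split: "{1..N} = {1..m} \<union> ?I" by (auto simp: m_def)
  \<comment> \<open>Each syndrome entry is the discrepancy between \<open>d\<close> and its
    re-encoding at one of the first \<open>m\<close> coordinates. On the last \<open>k\<close>
    coordinates the two agree anyway, so a zero syndrome forces a row vector to be a
    codeword.\<close>
  have check: "(\<Sum>n=1..N. d n * H n j) = d j - comb d j" if "j \<in> {1..m}" for d j
  proof -
    have "(\<Sum>n=1..N. d n * H n j) = (\<Sum>n=1..m. d n * H n j) + (\<Sum>n\<in>?I. d n * H n j)"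
      unfolding split by (rule sum.union_disjoint) auto
    also have "(\<Sum>n=1..m. d n * H n j) = (\<Sum>n=1..m. if n = j then d n else 0)"
      by (intro sum.cong) (auto simp: H_def)
    also have "\<dots> = d j" using that by (simp add: sum.delta)
    also have "(\<Sum>n\<in>?I. d n * H n j) = - comb d j"
      unfolding comb_apply sum_negf[symmetric] by (intro sum.cong) (auto simp: H_def)
    finally show ?thesis by simp
  qed
  have "d \<in> D \<longleftrightarrow> d \<in> row_vectors N \<and> (\<forall>j\<in>{1..m}. (\<Sum>n=1..N. d n * H n j) = 0)" for d
  proof
    assume "d \<in> D"
    then show "d \<in> row_vectors N \<and> (\<forall>j\<in>{1..m}. (\<Sum>n=1..N. d n * H n j) = 0)"
      using DN check comb_id by auto
  next
    assume *: "d \<in> row_vectors N \<and> (\<forall>j\<in>{1..m}. (\<Sum>n=1..N. d n * H n j) = 0)"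
    have "d n = comb d n" for n
    proof -
      consider "n \<in> {1..m}" | "n \<in> ?I" | "n \<notin> {1..N}" using split by blast
      then show ?thesis
      proof cases
        case 1 then show ?thesis using * check by auto
      next
        case 2 then show ?thesis using comb_I by simp
      next
        case 3
        then have "d n = 0" "comb d n = 0"
          using * combD[of d] DN unfolding row_vectors_def by blast+
        then show ?thesis by simp
      qed
    qed
    then have "d = comb d" by (rule ext)
    then show "d \<in> D" using combD[of d] by simp
  qed
  then have "parity_check_matrix N k D H"
    unfolding parity_check_matrix_def m_def[symmetric] by blast
  moreover have "systematic N k H"
    by (auto simp: systematic_def H_def m_def)
  ultimately show ?thesis by blast
qed

text \<open>A single nonzero vector is a basis of its span; \<open>0 < N\<close> makes the all-ones
  row nonzero.\<close>

lemma repetition_generator_matrix: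
  assumes "0 < N"
  shows "generator_matrix N 1 (repetition_code N)
    (repetition_generator N :: nat \<Rightarrow> nat \<Rightarrow> 'f::field)"
proof -
  let ?g = "repetition_generator N 1 :: nat \<Rightarrow> 'f"
  have "?g 1 \<noteq> 0" using assms by (simp add: repetition_generator_def)
  then have nz: "?g \<noteq> 0" by (metis zero_fun_apply)
  have "repetition_code N \<subseteq> (row_vectors N :: (nat \<Rightarrow> 'f) set)"
    unfolding repetition_code_def row.span_singleton
    by (auto simp: row_vectors_def row_scale_def repetition_generator_def)
  moreover have "row.dim (repetition_code N :: (nat \<Rightarrow> 'f) set) = 1"
    unfolding repetition_code_def using nz by (subst row.dim_span_eq_card_independent) auto
  ultimately show ?thesis
    using nz by (auto simp: generator_matrix_def linear_code_def indexed_basis_def repetition_code_def)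
qed

section \<open>Independence and mutual information\<close>

text \<open>The library's \<open>indep_var\<close> needs both variables to have the same type.\<close>

lemma (in prob_space) mutual_information_eq_0_if_indep:
  assumes X [measurable]: "random_variable S X" and Y [measurable]: "random_variable T Y"
    and indep: "\<And>A C. A \<in> sets S \<Longrightarrow> C \<in> sets T \<Longrightarrow>
      prob (X -` A \<inter> Y -` C \<inter> space M) = prob (X -` A \<inter> space M) * prob (Y -` C \<inter> space M)"
  shows "mutual_information b S T X Y = 0"
proof -
  let ?J = "distr M (S \<Otimes>\<^sub>M T) (\<lambda>x. (X x, Y x))"
  interpret X: prob_space "distr M S X" by (rule prob_space_distr) (rule X)
  interpret Y: prob_space "distr M T Y" by (rule prob_space_distr) (rule Y)
  interpret J: prob_space ?J by (rule prob_space_distr) measurable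
  \<comment> \<open>Independence gives equality on measurable rectangles, and these determine the
    product measure.\<close>
  have "distr M S X \<Otimes>\<^sub>M distr M T Y = ?J"
  proof (rule pair_measure_eqI)
    fix A C assume "A \<in> sets (distr M S X)" "C \<in> sets (distr M T Y)"
    then have [measurable]: "A \<in> sets S" "C \<in> sets T" by simp_all
    have "(\<lambda>x. (X x, Y x)) -` (A \<times> C) \<inter> space M = X -` A \<inter> Y -` C \<inter> space M"
      by auto
    then show "emeasure (distr M S X) A * emeasure (distr M T Y) C = emeasure ?J (A \<times> C)"
      by (simp add: emeasure_distr emeasure_eq_measure indep ennreal_mult)
  qed (simp_all add: X.sigma_finite_measure_axioms Y.sigma_finite_measure_axioms
      cong: sets_pair_measure_cong)
  \<comment> \<open>Mutual information is the divergence between the joint law and the product of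
    the marginals, which now coincide.\<close>
  then show ?thesis
    unfolding mutual_information_def by (simp add: J.KL_same_eq_0)
qed

text \<open>The factors of a product law are its marginals, so the probability of every rectangle
  factorises.\<close>

lemma mutual_information_eq_0_if_map_pmf_eq_pair_pmf:
  assumes joint: "map_pmf (\<lambda>\<omega>. (X \<omega>, Y \<omega>)) p = pair_pmf q r"
    and "range X \<subseteq> A" and "range Y \<subseteq> C"
  shows "prob_space.mutual_information (measure_pmf p) b (count_space A) (count_space C) X Y = 0"
proof (rule prob_space.mutual_information_eq_0_if_indep[OF measure_pmf.prob_space_axioms])
  have q: "map_pmf X p = q" and r: "map_pmf Y p = r"
    using arg_cong[OF joint, of "map_pmf fst"] arg_cong[OF joint, of "map_pmf snd"]
    by (simp_all add: map_pmf_comp map_fst_pair_pmf map_snd_pair_pmf)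
  fix U V
  have "measure_pmf.prob p (X -` U \<inter> Y -` V) = measure_pmf.prob (pair_pmf q r) (U \<times> V)"
    unfolding joint[symmetric] by (simp add: vimage_def Int_def)
  \<comment> \<open>Cutting down to the supports makes both sides of the rectangle countable, as the
    product formula requires.\<close>
  also have "\<dots> = measure_pmf.prob (pair_pmf q r) ((U \<inter> set_pmf q) \<times> (V \<inter> set_pmf r))"
    by (rule measure_prob_cong_0) (auto simp: pmf_pair set_pmf_iff)
  also have "\<dots> = measure_pmf.prob q (U \<inter> set_pmf q) * measure_pmf.prob r (V \<inter> set_pmf r)"
    by (intro measure_pmf_prob_product countable_Int2 countable_set_pmf)
  also have "\<dots> = measure_pmf.prob p (X -` U) * measure_pmf.prob p (Y -` V)"
    unfolding measure_Int_set_pmf by (simp add: q[symmetric] r[symmetric])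
  finally show "measure_pmf.prob p (X -` U \<inter> Y -` V \<inter> space (measure_pmf p)) =
      measure_pmf.prob p (X -` U \<inter> space (measure_pmf p)) *
      measure_pmf.prob p (Y -` V \<inter> space (measure_pmf p))"
    by simp
qed (use assms(2,3) in auto)

section \<open>The scheme\<close>

lemma sum_fun_apply: "(\<Sum>i\<in>A. f i) x = (\<Sum>i\<in>A. f i x)"
  by (induction A rule: infinite_finite_induct) auto

text \<open>Cancel in \<open>\<iota> (0 + 0) = \<iota> 0 + \<iota> 0\<close>.\<close>

lemma field_embedding_zero: "field_embedding \<iota> \<Longrightarrow> \<iota> 0 = 0"
  unfolding field_embedding_def by (metis add_cancel_right_right)

lemma field_embedding_sum:
  assumes "field_embedding \<iota>"
  shows "\<iota> (\<Sum>i\<in>A. f i) = (\<Sum>i\<in>A. \<iota> (f i))"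
  by (induction A rule: infinite_finite_induct)
    (use assms field_embedding_zero[OF assms] in \<open>auto simp: field_embedding_def\<close>)

text \<open>The basis \<open>\<psi>\<close> and the matrix \<open>H\<close> are arbitrary here, so
  the results hold for every admissible choice; that such choices exist is proved
  separately.\<close>

locale star_product =
  fixes \<iota> :: "'f::{field,finite} \<Rightarrow> 'k::{field,finite}"
    and N T B :: nat
    and D :: "(nat \<Rightarrow> 'f) set"
    and H :: "nat \<Rightarrow> nat \<Rightarrow> 'f"
    and \<Q> :: "('k, 'm::finite) fn set"
    and \<psi> :: "nat \<Rightarrow> ('k, 'm) fn"
    and law :: "(nat \<Rightarrow> ('k, 'm) fn) pmf"
  assumes embedding: "field_embedding \<iota>"
    and T_less: "T < N" and B_pos: "0 < B" and dvd: "(N - T) dvd B"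
    and mds: "mds_code N T D"
    and subspace_\<Q>: "module.subspace (fn_scale \<iota>) \<Q>"
    and set_law: "set_pmf law \<subseteq> ({1..B} \<rightarrow>\<^sub>E \<Q>)"
    and basis: "indexed_basis (fn_scale \<iota>) \<Q> (vector_space.dim (fn_scale \<iota>) \<Q>) \<psi>"
    and parity: "parity_check_matrix N T D H" and syst: "systematic N T H"
begin

sublocale fn: vector_space "fn_scale \<iota>"
  by (rule vector_space_fn_scale[OF embedding])

abbreviation "S \<equiv> B div (N - T)"
abbreviation "Q \<equiv> fn.dim \<Q>"
abbreviation "P \<equiv> star_product_scheme \<iota> N T B D H \<Q> \<psi> law"
abbreviation "query \<equiv> star_query \<iota> N T Q \<psi>"
text \<open>Outside the sampled index pairs a family takes the value zero, so that the families form
  a group under pointwise addition.\<close>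

abbreviation "codeword_families \<equiv> PiE_dflt ({1..S} \<times> {1..Q}) 0 (\<lambda>_. D)"
abbreviation "codeword_law \<equiv> Pi_pmf ({1..S} \<times> {1..Q}) 0 (\<lambda>_. pmf_of_set D)"

lemma scheme_simps [simp]:
  "query_space P = \<Q>" "block_length P = B" "iterations P = S" "function_law P = law"
  "query_law P \<phi> = map_pmf (query \<phi>) codeword_law"
  "decode P r b k = (\<Sum>n=1..N. r ((b - 1) div (N - T) + 1) n * \<iota> (H n ((b - 1) mod (N - T) + 1)))"
  by (simp_all add: star_product_scheme_def Let_def)

section \<open>The uniform law on codeword families\<close>

lemma subspace_D: "row.subspace D"
  using mds by (simp add: mds_code_def linear_code_def)

lemma zero_in_D: "0 \<in> D"
  by (rule row.subspace_0[OF subspace_D])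

lemma codeword_law_eq: "codeword_law = pmf_of_set codeword_families"
  using zero_in_D mds_code_finite[OF mds] by (intro Pi_pmf_of_set) auto

lemma codeword_families_finite: "finite codeword_families" "codeword_families \<noteq> {}"
  using zero_in_D mds_code_finite[OF mds] by auto

lemma set_codeword_law: "set_pmf codeword_law = codeword_families"
  unfolding codeword_law_eq using codeword_families_finite by (rule set_pmf_of_set[rotated])

text \<open>As \<open>D\<close> is a subspace, subtracting \<open>\<delta>\<close> inverts the
  translation within the families, and a bijection of a finite set preserves its uniform
  law.\<close>

lemma codeword_law_translate:
  assumes "\<delta> \<in> codeword_families"
  shows "map_pmf (\<lambda>d. d + \<delta>) codeword_law = codeword_law"
proof -
  have "bij_betw (\<lambda>d. d + \<delta>) codeword_families codeword_families"
    using assms row.subspace_add[OF subspace_D] row.subspace_diff[OF subspace_D]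
    by (intro bij_betwI[where g = "\<lambda>d. d - \<delta>"]) (simp_all add: PiE_dflt_def Pi_def)
  then show ?thesis
    unfolding codeword_law_eq using codeword_families_finite by (intro map_pmf_of_set_bij_betw)
qed

section \<open>Numbering the requested functions by iteration and server\<close>

lemma S_mult: "S * (N - T) = B"
  using dvd by simp

lemma block_index:
  assumes "s \<in> {1..S}" and "j \<in> {1..N - T}"
  shows "(s - 1) * (N - T) + j \<in> {1..B}"
proof -
  have "(s - 1) * (N - T) + j \<le> (s - 1) * (N - T) + (N - T)"
    using assms by simp
  also have "\<dots> = s * (N - T)"
    using assms by (cases s) auto
  also have "\<dots> \<le> S * (N - T)"
    using assms by (intro mult_right_mono) auto
  finally show ?thesis
    using assms S_mult by simp
qed

text \<open>Division with remainder recovers iteration and column from \<open>b\<close>; the shifts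
  by one are due to all three being numbered from 1.\<close>

lemma block_index_decode:
  assumes "b \<in> {1..B}"
  shows "(b - 1) div (N - T) + 1 \<in> {1..S}" and "(b - 1) mod (N - T) + 1 \<in> {1..N - T}"
    and "((b - 1) div (N - T) + 1 - 1) * (N - T) + ((b - 1) mod (N - T) + 1) = b"
proof -
  have "(b - 1) div (N - T) < S"
    using assms S_mult by (intro less_mult_imp_div_less) auto
  then show "(b - 1) div (N - T) + 1 \<in> {1..S}" by simp
  have "(b - 1) mod (N - T) < N - T"
    using T_less by simp
  then show "(b - 1) mod (N - T) + 1 \<in> {1..N - T}" by simp
  show "((b - 1) div (N - T) + 1 - 1) * (N - T) + ((b - 1) mod (N - T) + 1) = b"
    using assms by (simp add: div_mult_mod_eq[of "b - 1" "N - T", simplified])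
qed

section \<open>Correctness of decoding and the rate\<close>

lemma mask_in:
  assumes "\<phi> \<in> {1..B} \<rightarrow>\<^sub>E \<Q>" and "s \<in> {1..S}" and "n \<in> {1..N}"
  shows "(if n \<le> N - T then \<phi> ((s - 1) * (N - T) + n) else 0) \<in> \<Q>"
  using assms block_index[of s n] fn.subspace_0[OF subspace_\<Q>] by auto

lemma query_in:
  assumes "\<phi> \<in> {1..B} \<rightarrow>\<^sub>E \<Q>" and "s \<in> {1..S}" and "n \<in> {1..N}"
  shows "query \<phi> d s n \<in> \<Q>"
  unfolding star_query_def
  by (intro fn.subspace_add fn.subspace_sum fn.subspace_scale subspace_\<Q> mask_in assms
      fn.indexed_basis_in[OF basis])

text \<open>The response vector is a sum of evaluated codewords, which \<open>H\<close> annihilates,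
  and of requested values on the first \<open>N - T\<close> servers, where \<open>H\<close> is the
  identity.\<close>

lemma responses_decode:
  assumes d: "d \<in> codeword_families" and s: "s \<in> {1..S}" and j: "j \<in> {1..N - T}"
  shows "(\<Sum>n=1..N. query \<phi> d s n x * \<iota> (H n j)) = \<phi> ((s - 1) * (N - T) + j) x"
proof -
  have \<iota>_mult: "\<iota> (a * b) = \<iota> a * \<iota> b" for a b
    using embedding by (simp add: field_embedding_def)
  have \<iota>_0: "\<iota> 0 = 0" and \<iota>_1: "\<iota> 1 = 1"
    using embedding field_embedding_zero by (auto simp: field_embedding_def)
  have check: "(\<Sum>n=1..N. d (s, q) n * H n j) = 0" if "q \<in> {1..Q}" for q
  proof -
    have "d (s, q) \<in> D" using d s that by (auto simp: PiE_dflt_def)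
    then show ?thesis using parity j unfolding parity_check_matrix_def by blast
  qed
  have "(\<Sum>n=1..N. (\<Sum>q=1..Q. fn_scale \<iota> (d (s, q) n) (\<psi> q)) x * \<iota> (H n j))
      = (\<Sum>n=1..N. \<Sum>q=1..Q. \<psi> q x * \<iota> (d (s, q) n * H n j))"
    by (simp add: sum_fun_apply fn_scale_def sum_distrib_left sum_distrib_right \<iota>_mult mult_ac)
  \<comment> \<open>After exchanging the sums, additivity of \<open>\<iota>\<close> exposes for each
    \<open>q\<close> the image of a parity check of one codeword.\<close>
  also have "\<dots> = (\<Sum>q=1..Q. \<psi> q x * \<iota> (\<Sum>n=1..N. d (s, q) n * H n j))"
    by (subst sum.swap) (simp add: sum_distrib_left field_embedding_sum[OF embedding])
  also have "\<dots> = 0"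
    using check by (simp add: \<iota>_0)
  finally have codewords: "(\<Sum>n=1..N. (\<Sum>q=1..Q. fn_scale \<iota> (d (s, q) n) (\<psi> q)) x * \<iota> (H n j)) = 0" .
  \<comment> \<open>For \<open>n \<le> N - T\<close> the entry \<open>H n j\<close> is 1 or 0
    according to whether \<open>n = j\<close>; for larger \<open>n\<close> nothing was added to the
    query.\<close>
  have "(\<Sum>n=1..N. (if n \<le> N - T then \<phi> ((s - 1) * (N - T) + n) else 0) x * \<iota> (H n j))
      = (\<Sum>n=1..N. if n = j then \<phi> ((s - 1) * (N - T) + n) x else 0)"
    using j syst by (intro sum.cong) (auto simp: systematic_def \<iota>_0 \<iota>_1)
  also have "\<dots> = \<phi> ((s - 1) * (N - T) + j) x"
    using j by (auto simp: sum.delta)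
  finally show ?thesis
    using codewords by (simp add: star_query_def distrib_right sum.distrib)
qed

lemma server_data_repetition:
  assumes "n \<in> {1..N}"
  shows "server_data \<iota> 1 (repetition_generator N) X n = X 1"
  using assms embedding
  by (simp add: server_data_def repetition_generator_def field_embedding_def)

text \<open>Every outcome of positive probability arises from some codeword family, so decoding
  succeeds without error.\<close>

lemma is_pc_scheme: "is_pc_scheme \<iota> N 1 (repetition_code N) (repetition_generator N) P"
  unfolding is_pc_scheme_def scheme_simps
proof (intro conjI ballI, goal_cases)
  case 1
  show ?case using T_less by (intro repetition_generator_matrix) simp
next
  case 2
  show ?case by (rule set_law)
next
  case (3 \<omega>)
  then obtain \<phi> d where \<omega>: "\<omega> = (\<phi>, query \<phi> d)" and "\<phi> \<in> set_pmf law" and d: "d \<in> codeword_families"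
    unfolding scheme_law_def scheme_simps set_bind_pmf set_map_pmf set_codeword_law by blast
  then have \<phi>: "\<phi> \<in> {1..B} \<rightarrow>\<^sub>E \<Q>" using set_law by blast
  have "(\<Sum>n=1..N. (\<lambda>s\<in>{1..S}. \<lambda>n\<in>{1..N}. query \<phi> d s n (server_data \<iota> 1 (repetition_generator N) X n))
        ((b - 1) div (N - T) + 1) n * \<iota> (H n ((b - 1) mod (N - T) + 1))) = \<phi> b (X k)"
    if b: "b \<in> {1..B}" and k: "k \<in> {1..1}" for X :: "nat \<Rightarrow> 'k ^ 'm" and b k :: nat
  proof -
    define s j where s: "s = (b - 1) div (N - T) + 1" and j: "j = (b - 1) mod (N - T) + 1"
    note index = block_index_decode[OF b, folded s j]
    have "(\<Sum>n=1..N. (\<lambda>s\<in>{1..S}. \<lambda>n\<in>{1..N}. query \<phi> d s n (server_data \<iota> 1 (repetition_generator N) X n))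
        s n * \<iota> (H n j)) = (\<Sum>n=1..N. query \<phi> d s n (X 1) * \<iota> (H n j))"
      using index(1) by (intro sum.cong) (simp_all add: server_data_repetition del: One_nat_def)
    also have "\<dots> = \<phi> b (X 1)"
      using responses_decode[OF d index(1,2)] unfolding index(3) .
    finally show ?thesis using k by (simp add: s j)
  qed
  then show ?case
    unfolding \<omega> prod.case using query_in[OF \<phi>] by blast
qed

text \<open>Each iteration serves \<open>N - T\<close> functions, so \<open>B = S (N - T)\<close>
  and the nonzero \<open>S\<close> cancels.\<close>

lemma download_rate: "download_rate N 1 P = real (N - T) / real N"
proof -
  have "real B = real S * real (N - T)"
    by (metis S_mult of_nat_mult)
  moreover have "S \<noteq> 0" using B_pos S_mult by (metis mult_0 not_gr_zero)
  ultimately show ?thesis by (simp add: download_rate_def del: div_eq_0_iff)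
qed

section \<open>Privacy against colluding servers\<close>

text \<open>On a set of \<open>T\<close> servers the requested functions can be absorbed into the random
  codewords.\<close>

lemma query_absorb:
  assumes I: "I \<subseteq> {1..N}" "card I = T" and \<phi>: "\<phi> \<in> {1..B} \<rightarrow>\<^sub>E \<Q>"
  obtains \<delta> where "\<delta> \<in> codeword_families"
    and "\<And>d s n. s \<in> {1..S} \<Longrightarrow> n \<in> I \<Longrightarrow> query \<phi> d s n = query 0 (d + \<delta>) s n"
proof -
  let ?g = "\<lambda>s n. if n \<le> N - T then \<phi> ((s - 1) * (N - T) + n) else 0"
  define expands where
    "expands s n a \<longleftrightarrow> ?g s n = (\<Sum>q=1..Q. fn_scale \<iota> (a q) (\<psi> q))" for s n a
  have "\<exists>a. expands s n a" if "s \<in> {1..S}" "n \<in> I" for s n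
  proof -
    have "?g s n \<in> \<Q>"
      using that I(1) by (intro mask_in \<phi>) auto
    then show ?thesis
      unfolding expands_def by (rule fn.indexed_basis_expansion[OF basis]) (rule exI)
  qed
  then obtain a where "\<And>s n. s \<in> {1..S} \<Longrightarrow> n \<in> I \<Longrightarrow> expands s n (a s n)"
    by metis
  then have a: "\<And>s n. s \<in> {1..S} \<Longrightarrow> n \<in> I \<Longrightarrow> ?g s n = (\<Sum>q=1..Q. fn_scale \<iota> (a s n q) (\<psi> q))"
    by (simp only: expands_def)
  \<comment> \<open>For each basis index \<open>q\<close>, a single codeword interpolates the
    \<open>q\<close>-th coordinates of the functions added at the \<open>T\<close> servers.\<close>
  have "\<exists>c\<in>D. \<forall>n\<in>I. c n = a s n q" for s q
    by (rule mds_code_interpolation[OF mds I, of "\<lambda>n. a s n q"]) blast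
  then obtain c where c: "\<And>s q. c s q \<in> D" "\<And>s q n. n \<in> I \<Longrightarrow> c s q n = a s n q"
    by metis
  \<comment> \<open>The value zero outside the index range places \<open>\<delta>\<close> among the
    codeword families.\<close>
  define \<delta> where "\<delta> = (\<lambda>(s, q). if s \<in> {1..S} \<and> q \<in> {1..Q} then c s q else 0)"
  show thesis
  proof (rule that)
    show "\<delta> \<in> codeword_families"
      using c(1) by (auto simp: \<delta>_def PiE_dflt_def)
  next
    fix d s n assume s: "s \<in> {1..S}" and n: "n \<in> I"
    have "query \<phi> d s n
        = (\<Sum>q=1..Q. fn_scale \<iota> (d (s, q) n) (\<psi> q)) + (\<Sum>q=1..Q. fn_scale \<iota> (\<delta> (s, q) n) (\<psi> q))"
      unfolding star_query_def a[OF s n] using s n c(2) by (simp add: \<delta>_def)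
    also have "\<dots> = query 0 (d + \<delta>) s n"
      unfolding star_query_def by (simp add: fn.scale_left_distrib sum.distrib)
    finally show "query \<phi> d s n = query 0 (d + \<delta>) s n" .
  qed
qed

text \<open>Zero requests serve as the reference: absorbing \<open>\<phi>\<close> turns the
  observation for \<open>d\<close> into the reference observation for \<open>d + \<delta>\<close>,
  and \<open>d + \<delta>\<close> has the same law as \<open>d\<close>.\<close>

lemma observed_law:
  assumes I: "I \<subseteq> {1..N}" "card I = T" and \<phi>: "\<phi> \<in> {1..B} \<rightarrow>\<^sub>E \<Q>"
  shows "map_pmf (\<lambda>d. restrict (\<lambda>(s, n). query \<phi> d s n) ({1..S} \<times> I)) codeword_law
    = map_pmf (\<lambda>d. restrict (\<lambda>(s, n). query 0 d s n) ({1..S} \<times> I)) codeword_law"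
    (is "map_pmf (?obs \<phi>) _ = _")
proof -
  obtain \<delta> where \<delta>: "\<delta> \<in> codeword_families"
    and absorb: "\<And>d s n. s \<in> {1..S} \<Longrightarrow> n \<in> I \<Longrightarrow> query \<phi> d s n = query 0 (d + \<delta>) s n"
    using query_absorb[OF I \<phi>] by blast
  have "?obs \<phi> d = ?obs 0 (d + \<delta>)" for d
  proof (rule restrict_ext)
    fix x assume "x \<in> {1..S} \<times> I"
    then obtain s n where "x = (s, n)" "s \<in> {1..S}" "n \<in> I" by blast
    then show "(case x of (s, n) \<Rightarrow> query \<phi> d s n) = (case x of (s, n) \<Rightarrow> query 0 (d + \<delta>) s n)"
      using absorb by (simp only: prod.case)
  qed
  then have "map_pmf (?obs \<phi>) codeword_law = map_pmf (?obs 0) (map_pmf (\<lambda>d. d + \<delta>) codeword_law)"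
    by (simp only: map_pmf_comp)
  then show ?thesis
    by (simp only: codeword_law_translate[OF \<delta>])
qed

lemma protects_against_collusion: "protects_against_collusion N T P"
  unfolding protects_against_collusion_def
proof (intro allI impI, elim conjE)
  fix I assume I: "I \<subseteq> {1..N}" "card I = T"
  let ?X = "requested_functions P" and ?Y = "observed_queries P I"
  let ?obs = "\<lambda>\<phi> d. restrict (\<lambda>(s, n). query \<phi> d s n) ({1..S} \<times> I)"
  have "map_pmf (\<lambda>\<omega>. (?X \<omega>, ?Y \<omega>)) (scheme_law P)
      = bind_pmf law (\<lambda>\<phi>. map_pmf (Pair (restrict \<phi> {1..B})) (map_pmf (?obs \<phi>) codeword_law))"
    by (simp add: scheme_law_def map_bind_pmf map_pmf_comp requested_functions_def observed_queries_def)
  \<comment> \<open>The conditional law of the observation is replaced by one free of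
    \<open>\<phi>\<close>; the joint law is then a product.\<close>
  also have "\<dots> = bind_pmf law (\<lambda>\<phi>. map_pmf (Pair (restrict \<phi> {1..B})) (map_pmf (?obs 0) codeword_law))"
    using set_law by (intro bind_pmf_cong refl arg_cong[where f = "map_pmf _"] observed_law I) auto
  also have "\<dots> = pair_pmf (map_pmf (\<lambda>\<phi>. restrict \<phi> {1..B}) law) (map_pmf (?obs 0) codeword_law)"
    by (simp add: pair_pmf_def bind_map_pmf map_pmf_def bind_assoc_pmf bind_return_pmf)
  finally show "protects_against I P"
    unfolding protects_against_def
    by (rule mutual_information_eq_0_if_map_pmf_eq_pair_pmf) auto
qed

end

text \<open>The two existence claims ensure that the statement about all bases and all systematic
  parity-check matrices is not vacuous.\<close>

theorem theorem1:
  fixes \<iota> :: "'f::{field,finite} \<Rightarrow> 'k::{field,finite}"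
    and N T B :: nat
    and D :: "(nat \<Rightarrow> 'f) set"
    and \<Q> :: "('k, 'm::finite) fn set"
    and law :: "(nat \<Rightarrow> ('k, 'm) fn) pmf"
  assumes "field_embedding \<iota>"
    and "0 < T" and "T < N" and "0 < B" and "(N - T) dvd B"
    and "mds_code N T D"
    and "module.subspace (fn_scale \<iota>) \<Q>"
    and "set_pmf law \<subseteq> ({1..B} \<rightarrow>\<^sub>E \<Q>)"
  shows "(\<exists>\<psi>. indexed_basis (fn_scale \<iota>) \<Q> (vector_space.dim (fn_scale \<iota>) \<Q>) \<psi>) \<and>
    (\<exists>H. parity_check_matrix N T D H \<and> systematic N T H) \<and>
    (\<forall>\<psi> H. indexed_basis (fn_scale \<iota>) \<Q> (vector_space.dim (fn_scale \<iota>) \<Q>) \<psi> \<and>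
       parity_check_matrix N T D H \<and> systematic N T H \<longrightarrow>
       (let P = star_product_scheme \<iota> N T B D H \<Q> \<psi> law in
        is_pc_scheme \<iota> N 1 (repetition_code N) (repetition_generator N) P \<and>
        protects_against_collusion N T P \<and>
        download_rate N 1 P = real (N - T) / real N))"
proof (intro conjI allI impI)
  \<comment> \<open>\<open>\<Q>\<close> is finite, being a set of functions between finite
    types.\<close>
  show "\<exists>\<psi>. indexed_basis (fn_scale \<iota>) \<Q> (vector_space.dim (fn_scale \<iota>) \<Q>) \<psi>"
    using assms(7) by (intro vector_space.indexed_basis_exists vector_space_fn_scale assms(1)) auto
  show "\<exists>H. parity_check_matrix N T D H \<and> systematic N T H"
    using assms(3,6) by (intro mds_code_systematic_parity_check) auto
  fix \<psi> H
  assume "indexed_basis (fn_scale \<iota>) \<Q> (vector_space.dim (fn_scale \<iota>) \<Q>) \<psi> \<and>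
    parity_check_matrix N T D H \<and> systematic N T H"
  then interpret star_product \<iota> N T B D H \<Q> \<psi> law
    using assms by unfold_locales auto
  show "let P = star_product_scheme \<iota> N T B D H \<Q> \<psi> law in
      is_pc_scheme \<iota> N 1 (repetition_code N) (repetition_generator N) P \<and>
      protects_against_collusion N T P \<and>
      download_rate N 1 P = real (N - T) / real N"
    unfolding Let_def using is_pc_scheme protects_against_collusion download_rate by blast
qed

end
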